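(* Let $K$ be a field, $S=K[x_1,\ldots,x_n]$, $\mathfrak m=(x_1,\ldots,x_n)$, and let $I\subset S$ be a squarefree strongly stable principal ideal with Borel generator $u\neq x_1$, where $u$ is a squarefree monomial of degree $d\ge 1$. Then $\mathfrak m\in\operatorname{Ass}(I^k)$ for some $k\ge 1$ if and only if $\min(u)>1$ and $\max(u)=n$.
   Context: For an ideal $J\subset S$, $\operatorname{Ass}(J)$ denotes the set of associated prime ideals of $S/J$. For a monomial $u\ne 1$, $\min(u)$ and $\max(u)$ denote the smallest and largest index $i$ such that $x_i\mid u$. For a monomial ideal $I$, $G(I)$ denotes its unique minimal set of monomial generators. A monomial ideal $I\subset S$ generated in a single degree is squarefree strongly stable if all $u\in G(I)$ are squarefree and, for every $u\in G(I)$ and all $1\le i<j\le n$ such that $x_j\mid u$ and $x_i\nmid u$, one has $x_i(u/x_j)\in G(I)$. It is a squarefree strongly stable principal ideal with Borel generator $u\in G(I)$ if it is the smallest squarefree strongly stable ideal containing $u$. Explicitly, if $u=x_{i_1}\cdots x_{i_d}$ with $1\le i_1<\cdots<i_d\le n$, then $G(I)=\{x_{j_1}\cdots x_{j_d} : 1\le j_1<\cdots<j_d\le n,\ j_k\le i_k \text{ for } 1\le k\le d\}$. *)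

theory Defs
  imports "HOL-Library.Poly_Mapping" "HOL-Algebra.QuotRing" "HOL-Algebra.Ideal_Product"
begin

section \<open>The polynomial ring\<close>

text \<open>
  A monomial is represented by its exponent vector, of type \<^typ>\<open>nat \<Rightarrow>\<^sub>0 nat\<close>, so the product of
  monomials is the sum of exponent vectors and \<open>x\<^sub>i\<close> divides \<open>a\<close> iff \<open>i \<in> keys a\<close>. A polynomial is a
  finitely supported map from exponent vectors to coefficients, with the convolution product of
  \<open>Poly_Mapping\<close>. The variables of \<open>K[x\<^sub>1,\<dots>,x\<^sub>n]\<close> are those with index in \<open>{1..n}\<close>.
\<close>

definition monoms :: "nat \<Rightarrow> (nat \<Rightarrow>\<^sub>0 nat) set"
  where "monoms n = {a. Poly_Mapping.keys a \<subseteq> {1..n}}"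

definition mpoly_ring :: "nat \<Rightarrow> ((nat \<Rightarrow>\<^sub>0 nat) \<Rightarrow>\<^sub>0 'k::field) ring"
  where "mpoly_ring n = \<lparr>carrier = {p. Poly_Mapping.keys p \<subseteq> monoms n},
    mult = (*), one = 1, zero = 0, add = (+)\<rparr>"

definition monom_poly :: "(nat \<Rightarrow>\<^sub>0 nat) \<Rightarrow> ((nat \<Rightarrow>\<^sub>0 nat) \<Rightarrow>\<^sub>0 'k::field)"
  where "monom_poly a = Poly_Mapping.single a 1"

definition var :: "nat \<Rightarrow> (nat \<Rightarrow>\<^sub>0 nat)"
  where "var i = Poly_Mapping.single i 1"

definition mon_degree :: "(nat \<Rightarrow>\<^sub>0 nat) \<Rightarrow> nat"
  where "mon_degree a = (\<Sum>i\<in>Poly_Mapping.keys a. Poly_Mapping.lookup a i)"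

definition mon_squarefree :: "(nat \<Rightarrow>\<^sub>0 nat) \<Rightarrow> bool"
  where "mon_squarefree a \<longleftrightarrow> (\<forall>i. Poly_Mapping.lookup a i \<le> 1)"

definition mon_min :: "(nat \<Rightarrow>\<^sub>0 nat) \<Rightarrow> nat"
  where "mon_min a = Min (Poly_Mapping.keys a)"

definition mon_max :: "(nat \<Rightarrow>\<^sub>0 nat) \<Rightarrow> nat"
  where "mon_max a = Max (Poly_Mapping.keys a)"

definition max_hom_ideal :: "nat \<Rightarrow> ((nat \<Rightarrow>\<^sub>0 nat) \<Rightarrow>\<^sub>0 'k::field) set"
  where "max_hom_ideal n = Idl\<^bsub>mpoly_ring n\<^esub> (monom_poly ` var ` {1..n})"

section \<open>Associated primes\<close>

text \<open>
  The associated primes of the \<open>R\<close>-module \<open>R/J\<close>: the prime ideals of \<open>R\<close> that are annihilators of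
  an element of \<open>R/J\<close>, where \<open>r\<close> acts as multiplication by its coset.
\<close>

definition Ass :: "('a, 'b) ring_scheme \<Rightarrow> 'a set \<Rightarrow> 'a set set"
  where "Ass R J = {P. primeideal P R \<and>
    (\<exists>x\<in>carrier (R Quot J).
      P = {r \<in> carrier R. (J +>\<^bsub>R\<^esub> r) \<otimes>\<^bsub>R Quot J\<^esub> x = \<zero>\<^bsub>R Quot J\<^esub>})}"

section \<open>Monomial ideals and squarefree strongly stable principal ideals\<close>

definition monomial_ideal :: "nat \<Rightarrow> ((nat \<Rightarrow>\<^sub>0 nat) \<Rightarrow>\<^sub>0 'k::field) set \<Rightarrow> bool"
  where "monomial_ideal n I \<longleftrightarrow> (\<exists>A\<subseteq>monoms n. I = Idl\<^bsub>mpoly_ring n\<^esub> (monom_poly ` A))"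

definition is_min_mon_gens ::
  "nat \<Rightarrow> ((nat \<Rightarrow>\<^sub>0 nat) \<Rightarrow>\<^sub>0 'k::field) set \<Rightarrow> (nat \<Rightarrow>\<^sub>0 nat) set \<Rightarrow> bool"
  where "is_min_mon_gens n I A \<longleftrightarrow> A \<subseteq> monoms n \<and> I = Idl\<^bsub>mpoly_ring n\<^esub> (monom_poly ` A) \<and>
    (\<forall>B. B \<subset> A \<longrightarrow> I \<noteq> Idl\<^bsub>mpoly_ring n\<^esub> (monom_poly ` B))"

text \<open>The set \<open>G(I)\<close>. It is well defined for monomial ideals by \<open>ex1_min_mon_gens\<close> below.\<close>

definition min_gens :: "nat \<Rightarrow> ((nat \<Rightarrow>\<^sub>0 nat) \<Rightarrow>\<^sub>0 'k::field) set \<Rightarrow> (nat \<Rightarrow>\<^sub>0 nat) set"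
  where "min_gens n I = (THE A. is_min_mon_gens n I A)"

text \<open>The exponent vector \<^term>\<open>var i + (u - var j)\<close> is that of \<open>x\<^sub>i (u/x\<^sub>j)\<close>, as \<open>x\<^sub>j\<close> divides \<open>u\<close>.\<close>

definition squarefree_strongly_stable :: "nat \<Rightarrow> ((nat \<Rightarrow>\<^sub>0 nat) \<Rightarrow>\<^sub>0 'k::field) set \<Rightarrow> bool"
  where "squarefree_strongly_stable n I \<longleftrightarrow> monomial_ideal n I \<and>
    (\<exists>d. \<forall>u\<in>min_gens n I. mon_degree u = d) \<and>
    (\<forall>u\<in>min_gens n I. mon_squarefree u) \<and>
    (\<forall>u\<in>min_gens n I. \<forall>i j. 1 \<le> i \<and> i < j \<and> j \<le> n \<and>
        j \<in> Poly_Mapping.keys u \<and> i \<notin> Poly_Mapping.keys u \<longrightarrow>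
        var i + (u - var j) \<in> min_gens n I)"

definition sss_principal :: "nat \<Rightarrow> ((nat \<Rightarrow>\<^sub>0 nat) \<Rightarrow>\<^sub>0 'k::field) set \<Rightarrow> (nat \<Rightarrow>\<^sub>0 nat) \<Rightarrow> bool"
  where "sss_principal n I u \<longleftrightarrow> squarefree_strongly_stable n I \<and> u \<in> min_gens n I \<and>
    (\<forall>J. squarefree_strongly_stable n J \<and> monom_poly u \<in> J \<longrightarrow> I \<subseteq> J)"

section \<open>Well-definedness\<close>

lemma monoms_add: "a \<in> monoms n \<Longrightarrow> b \<in> monoms n \<Longrightarrow> a + b \<in> monoms n"
  unfolding monoms_def using Poly_Mapping.keys_add[of a b] by blast

lemma monoms_addD: "a + b \<in> monoms n \<Longrightarrow> a \<in> monoms n \<and> b \<in> monoms n"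
  unfolding monoms_def by (auto simp: in_keys_iff lookup_add subset_iff)

lemma mpoly_ring_simps:
  "carrier (mpoly_ring n) = {p. Poly_Mapping.keys p \<subseteq> monoms n}"
  "x \<otimes>\<^bsub>mpoly_ring n\<^esub> y = x * y" "x \<oplus>\<^bsub>mpoly_ring n\<^esub> y = x + y"
  "\<one>\<^bsub>mpoly_ring n\<^esub> = 1" "\<zero>\<^bsub>mpoly_ring n\<^esub> = 0"
  by (simp_all add: mpoly_ring_def)

lemma mpoly_add_closed:
  fixes p q :: "(nat \<Rightarrow>\<^sub>0 nat) \<Rightarrow>\<^sub>0 'k::field"
  shows "Poly_Mapping.keys p \<subseteq> monoms n \<Longrightarrow> Poly_Mapping.keys q \<subseteq> monoms n \<Longrightarrow>
    Poly_Mapping.keys (p + q) \<subseteq> monoms n"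
  using Poly_Mapping.keys_add[of p q] by blast

lemma mpoly_mult_closed:
  fixes p q :: "(nat \<Rightarrow>\<^sub>0 nat) \<Rightarrow>\<^sub>0 'k::field"
  shows "Poly_Mapping.keys p \<subseteq> monoms n \<Longrightarrow> Poly_Mapping.keys q \<subseteq> monoms n \<Longrightarrow>
    Poly_Mapping.keys (p * q) \<subseteq> monoms n"
  using Poly_Mapping.keys_mult[of p q] by (fastforce intro: monoms_add)

lemma cring_mpoly_ring: "cring (mpoly_ring n :: ((nat \<Rightarrow>\<^sub>0 nat) \<Rightarrow>\<^sub>0 'k::field) ring)"
proof (rule cringI)
  let ?R = "mpoly_ring n :: ((nat \<Rightarrow>\<^sub>0 nat) \<Rightarrow>\<^sub>0 'k::field) ring"
  show "abelian_group ?R"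
  proof (rule abelian_groupI)
    fix x assume "x \<in> carrier ?R"
    moreover have "Poly_Mapping.keys (- x) = Poly_Mapping.keys x"
      by (auto simp: in_keys_iff)
    ultimately show "\<exists>y\<in>carrier ?R. y \<oplus>\<^bsub>?R\<^esub> x = \<zero>\<^bsub>?R\<^esub>"
      by (intro bexI[of _ "- x"]) (simp_all add: mpoly_ring_simps)
  qed (simp_all add: mpoly_ring_simps mpoly_add_closed ac_simps)
  show "comm_monoid (mpoly_ring n :: ((nat \<Rightarrow>\<^sub>0 nat) \<Rightarrow>\<^sub>0 'k::field) ring)"
    by (rule comm_monoidI, simp_all add: mpoly_ring_simps mpoly_mult_closed ac_simps)
       (simp add: monoms_def)
qed (simp add: mpoly_ring_simps algebra_simps)

lemma uminus_mpoly_ring: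
  fixes p :: "(nat \<Rightarrow>\<^sub>0 nat) \<Rightarrow>\<^sub>0 'k::field"
  assumes "p \<in> carrier (mpoly_ring n)"
  shows "\<ominus>\<^bsub>mpoly_ring n\<^esub> p = - p"
proof -
  interpret cring "mpoly_ring n :: ((nat \<Rightarrow>\<^sub>0 nat) \<Rightarrow>\<^sub>0 'k) ring" by (rule cring_mpoly_ring)
  have "p + \<ominus>\<^bsub>mpoly_ring n\<^esub> p = 0"
    using r_neg[OF assms] by (simp add: mpoly_ring_simps)
  then show ?thesis by (simp add: add_eq_0_iff)
qed

definition upset :: "nat \<Rightarrow> (nat \<Rightarrow>\<^sub>0 nat) set \<Rightarrow> (nat \<Rightarrow>\<^sub>0 nat) set"
  where "upset n A = {b + c | b c. b \<in> A \<and> c \<in> monoms n}"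

lemma upset_add: "a \<in> upset n A \<Longrightarrow> c \<in> monoms n \<Longrightarrow> a + c \<in> upset n A"
  unfolding upset_def using monoms_add by (fastforce simp: add.assoc)

lemma upset_superset: "A \<subseteq> upset n A"
proof
  fix a assume "a \<in> A"
  moreover have "a = a + 0" "0 \<in> monoms n" by (simp_all add: monoms_def)
  ultimately show "a \<in> upset n A" unfolding upset_def by blast
qed

lemma Idl_monom_poly:
  fixes A :: "(nat \<Rightarrow>\<^sub>0 nat) set"
  assumes A: "A \<subseteq> monoms n"
  shows "Idl\<^bsub>mpoly_ring n\<^esub> (monom_poly ` A) =
    {p :: (nat \<Rightarrow>\<^sub>0 nat) \<Rightarrow>\<^sub>0 'k::field. Poly_Mapping.keys p \<subseteq> upset n A}" (is "_ = ?U")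
proof
  let ?R = "mpoly_ring n :: ((nat \<Rightarrow>\<^sub>0 nat) \<Rightarrow>\<^sub>0 'k) ring"
  interpret cring ?R by (rule cring_mpoly_ring)
  have up: "upset n A \<subseteq> monoms n"
    using A by (auto simp: upset_def intro: monoms_add)
  have mult: "Poly_Mapping.keys (a * x) \<subseteq> upset n A"
    if "Poly_Mapping.keys a \<subseteq> upset n A" "Poly_Mapping.keys x \<subseteq> monoms n"
    for a x :: "(nat \<Rightarrow>\<^sub>0 nat) \<Rightarrow>\<^sub>0 'k"
  proof
    fix m assume "m \<in> Poly_Mapping.keys (a * x)"
    then obtain b c where "m = b + c" "b \<in> Poly_Mapping.keys a" "c \<in> Poly_Mapping.keys x"
      using Poly_Mapping.keys_mult[of a x] by blast
    with that show "m \<in> upset n A" by (auto intro!: upset_add)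
  qed
  have "ideal ?U ?R"
  proof (rule idealI)
    show "ring ?R" by (rule ring_axioms)
    show "subgroup ?U (add_monoid ?R)"
    proof (rule add.subgroupI)
      show "?U \<noteq> {}" by (auto intro: exI[of _ 0])
      show "?U \<subseteq> carrier ?R" using up by (auto simp: mpoly_ring_simps)
      show "\<And>a. a \<in> ?U \<Longrightarrow> \<ominus>\<^bsub>?R\<^esub> a \<in> ?U"
        using up by (subst uminus_mpoly_ring) (auto simp: mpoly_ring_simps in_keys_iff)
      show "a \<oplus>\<^bsub>?R\<^esub> b \<in> ?U" if "a \<in> ?U" "b \<in> ?U" for a b
        using that Poly_Mapping.keys_add[of a b] by (auto simp: mpoly_ring_simps)
    qed
    show "a \<otimes>\<^bsub>?R\<^esub> x \<in> ?U" if "a \<in> ?U" "x \<in> carrier ?R" for a x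
      using mult[of a x] that by (simp add: mpoly_ring_simps)
    then show "x \<otimes>\<^bsub>?R\<^esub> a \<in> ?U" if "a \<in> ?U" "x \<in> carrier ?R" for a x
      using that by (simp add: mpoly_ring_simps mult.commute[of x a])
  qed
  moreover have "monom_poly ` A \<subseteq> ?U"
    using upset_superset[of A n] by (auto simp: monom_poly_def)
  ultimately show "Idl\<^bsub>?R\<^esub> (monom_poly ` A) \<subseteq> ?U" by (rule genideal_minimal)
  show "?U \<subseteq> Idl\<^bsub>?R\<^esub> (monom_poly ` A)"
  proof
    fix p assume "p \<in> ?U"
    have sub: "monom_poly ` A \<subseteq> carrier ?R"
      using A by (auto simp: mpoly_ring_simps monom_poly_def)
    interpret I: ideal "Idl\<^bsub>?R\<^esub> (monom_poly ` A)" ?R by (rule genideal_ideal[OF sub])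
    have step: "Poly_Mapping.single (b + c) v \<in> Idl\<^bsub>?R\<^esub> (monom_poly ` A)"
      if "b \<in> A" "c \<in> monoms n" for b c and v :: 'k
    proof -
      have "Poly_Mapping.single c v \<in> carrier ?R"
        using that by (simp add: mpoly_ring_simps)
      moreover have "monom_poly b \<in> Idl\<^bsub>?R\<^esub> (monom_poly ` A)"
        using genideal_self[OF sub] that by blast
      ultimately have "monom_poly b \<otimes>\<^bsub>?R\<^esub> Poly_Mapping.single c v \<in> Idl\<^bsub>?R\<^esub> (monom_poly ` A)"
        by (intro I.I_r_closed)
      then show ?thesis by (simp add: mpoly_ring_simps monom_poly_def mult_single)
    qed
    have zero: "0 \<in> Idl\<^bsub>?R\<^esub> (monom_poly ` A)"
      using I.zero_closed by (simp add: mpoly_ring_simps)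
    have add: "x + y \<in> Idl\<^bsub>?R\<^esub> (monom_poly ` A)"
      if "x \<in> Idl\<^bsub>?R\<^esub> (monom_poly ` A)" "y \<in> Idl\<^bsub>?R\<^esub> (monom_poly ` A)" for x y
      using I.a_closed[OF that] by (simp add: mpoly_ring_simps)
    from \<open>p \<in> ?U\<close> have "Poly_Mapping.keys p \<subseteq> upset n A" by simp
    then show "p \<in> Idl\<^bsub>?R\<^esub> (monom_poly ` A)"
    proof (induction p rule: update_induct)
      case const
      show ?case by (rule zero)
    next
      case (update f a v)
      have *: "Poly_Mapping.update a v f = Poly_Mapping.single a v + f"
        using update(1)
        by (intro poly_mapping_eqI) (auto simp: lookup_update lookup_add lookup_single in_keys_iff)
      have k: "Poly_Mapping.keys (Poly_Mapping.update a v f) = insert a (Poly_Mapping.keys f)"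
        using update(2) by (simp add: keys_update)
      have "a \<in> upset n A" using update(4) k by simp
      then obtain b c where "a = b + c" "b \<in> A" "c \<in> monoms n"
        unfolding upset_def by blast
      then have "Poly_Mapping.single a v \<in> Idl\<^bsub>?R\<^esub> (monom_poly ` A)"
        using step by simp
      moreover have "f \<in> Idl\<^bsub>?R\<^esub> (monom_poly ` A)"
        using update(3,4) k by simp
      ultimately show ?case unfolding * by (rule add)
    qed
  qed
qed

lemma Idl_monom_poly_eq_iff:
  assumes "A \<subseteq> monoms n" "B \<subseteq> monoms n"
  shows "(Idl\<^bsub>mpoly_ring n\<^esub> (monom_poly ` A) :: ((nat \<Rightarrow>\<^sub>0 nat) \<Rightarrow>\<^sub>0 'k::field) set) =
      Idl\<^bsub>mpoly_ring n\<^esub> (monom_poly ` B) \<longleftrightarrow> upset n A = upset n B"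
proof
  assume eq: "(Idl\<^bsub>mpoly_ring n\<^esub> (monom_poly ` A) :: ((nat \<Rightarrow>\<^sub>0 nat) \<Rightarrow>\<^sub>0 'k::field) set) =
      Idl\<^bsub>mpoly_ring n\<^esub> (monom_poly ` B)"
  have "a \<in> upset n A \<longleftrightarrow> a \<in> upset n B" for a
  proof -
    have "(monom_poly a :: (nat \<Rightarrow>\<^sub>0 nat) \<Rightarrow>\<^sub>0 'k) \<in> Idl\<^bsub>mpoly_ring n\<^esub> (monom_poly ` C) \<longleftrightarrow>
        a \<in> upset n C" if "C \<subseteq> monoms n" for C
      unfolding Idl_monom_poly[OF that] by (simp add: monom_poly_def)
    with eq assms show ?thesis by blast
  qed
  then show "upset n A = upset n B" by blast
qed (simp add: Idl_monom_poly assms)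

definition mon_minimal :: "nat \<Rightarrow> (nat \<Rightarrow>\<^sub>0 nat) set \<Rightarrow> (nat \<Rightarrow>\<^sub>0 nat) set"
  where "mon_minimal n A = {a\<in>A. \<forall>b\<in>A. \<forall>c\<in>monoms n. a = b + c \<longrightarrow> c = 0}"

lemma mon_degree_add:
  fixes a b :: "nat \<Rightarrow>\<^sub>0 nat"
  shows "mon_degree (a + b) = mon_degree a + mon_degree b"
proof -
  let ?K = "Poly_Mapping.keys a \<union> Poly_Mapping.keys b"
  have *: "mon_degree c = (\<Sum>i\<in>?K. Poly_Mapping.lookup c i)"
    if "Poly_Mapping.keys c \<subseteq> ?K" for c :: "nat \<Rightarrow>\<^sub>0 nat"
    unfolding mon_degree_def
    by (rule sum.mono_neutral_left) (use that in \<open>auto simp: in_keys_iff\<close>)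
  show ?thesis
    using *[of "a + b"] *[of a] *[of b] Poly_Mapping.keys_add[of a b]
    by (simp add: lookup_add sum.distrib)
qed

lemma mon_degree_eq_0: "mon_degree a = 0 \<Longrightarrow> a = 0"
  unfolding mon_degree_def by (intro poly_mapping_eqI) (auto simp: in_keys_iff)

lemma upset_mon_minimal: "upset n (mon_minimal n (upset n A)) = upset n A"
proof (intro equalityI subsetI)
  fix a assume "a \<in> upset n (mon_minimal n (upset n A))"
  then show "a \<in> upset n A"
    unfolding upset_def[of n "mon_minimal n (upset n A)"]
    by (auto simp: mon_minimal_def intro: upset_add)
next
  fix a assume "a \<in> upset n A"
  then show "a \<in> upset n (mon_minimal n (upset n A))"
  proof (induction "mon_degree a" arbitrary: a rule: less_induct)
    case less
    show ?case
    proof (cases "a \<in> mon_minimal n (upset n A)")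
      case True
      then show ?thesis using upset_superset by blast
    next
      case False
      then obtain b c where bc: "b \<in> upset n A" "c \<in> monoms n" "a = b + c" "c \<noteq> 0"
        using less.prems unfolding mon_minimal_def by blast
      then have "mon_degree b < mon_degree a"
        using mon_degree_eq_0[of c] by (auto simp: mon_degree_add)
      with less.hyps bc show ?thesis by (auto intro: upset_add)
    qed
  qed
qed

lemma is_min_mon_gens_iff:
  assumes A: "A \<subseteq> monoms n"
  shows "is_min_mon_gens n (Idl\<^bsub>mpoly_ring n\<^esub> (monom_poly ` A) :: ((nat \<Rightarrow>\<^sub>0 nat) \<Rightarrow>\<^sub>0 'k::field) set) G
    \<longleftrightarrow> G = mon_minimal n (upset n A)"
proof -
  let ?M = "mon_minimal n (upset n A)"
  have M: "?M \<subseteq> monoms n"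
    using A by (auto simp: mon_minimal_def upset_def intro: monoms_add)
  have least: "?M \<subseteq> B" if "B \<subseteq> monoms n" "upset n B = upset n A" for B
  proof
    fix a assume a: "a \<in> ?M"
    then have "a \<in> upset n B" using that by (simp add: mon_minimal_def)
    then obtain b c where bc: "b \<in> B" "c \<in> monoms n" "a = b + c" by (auto simp: upset_def)
    moreover have "b \<in> upset n A" using upset_superset[of B n] bc that by blast
    ultimately have "c = 0" using a by (auto simp: mon_minimal_def)
    with bc show "a \<in> B" by simp
  qed
  have iff: "is_min_mon_gens n (Idl\<^bsub>mpoly_ring n\<^esub> (monom_poly ` A) :: ((nat \<Rightarrow>\<^sub>0 nat) \<Rightarrow>\<^sub>0 'k::field) set) G
    \<longleftrightarrow> G \<subseteq> monoms n \<and> upset n A = upset n G \<and> (\<forall>B. B \<subset> G \<longrightarrow> upset n A \<noteq> upset n B)"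
  proof (cases "G \<subseteq> monoms n")
    case True
    have eq: "(Idl\<^bsub>mpoly_ring n\<^esub> (monom_poly ` A) :: ((nat \<Rightarrow>\<^sub>0 nat) \<Rightarrow>\<^sub>0 'k::field) set) =
        Idl\<^bsub>mpoly_ring n\<^esub> (monom_poly ` B) \<longleftrightarrow> upset n A = upset n B" if "B \<subseteq> G" for B
      using Idl_monom_poly_eq_iff[OF A, where 'k = 'k] that True by blast
    show ?thesis
      unfolding is_min_mon_gens_def using True eq by (auto simp: psubset_imp_subset)
  qed (simp add: is_min_mon_gens_def)
  show ?thesis unfolding iff
  proof
    assume G: "G \<subseteq> monoms n \<and> upset n A = upset n G \<and> (\<forall>B. B \<subset> G \<longrightarrow> upset n A \<noteq> upset n B)"
    then have "?M \<subseteq> G" using least by simp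
    moreover have "\<not> ?M \<subset> G" using G upset_mon_minimal[of n A] by blast
    ultimately show "G = ?M" by blast
  next
    assume G: "G = ?M"
    have "upset n A \<noteq> upset n B" if "B \<subset> ?M" for B
      using least[of B] that M by (auto dest: sym)
    then show "G \<subseteq> monoms n \<and> upset n A = upset n G \<and> (\<forall>B. B \<subset> G \<longrightarrow> upset n A \<noteq> upset n B)"
      unfolding G using M upset_mon_minimal[of n A] by simp
  qed
qed

lemma ex1_min_mon_gens:
  assumes "monomial_ideal n I"
  shows "\<exists>!A. is_min_mon_gens n I A"
proof -
  obtain A where A: "A \<subseteq> monoms n" "I = Idl\<^bsub>mpoly_ring n\<^esub> (monom_poly ` A)"
    using assms unfolding monomial_ideal_def by auto
  show ?thesis
    unfolding A(2) is_min_mon_gens_iff[OF A(1)] by simp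
qed

end

theory Submission
  imports Defs
begin

text \<open>
  A power \<open>I\<^sup>k\<close> is a monomial ideal, so \<open>\<mm>\<close> is associated to it iff some monomial
  \<open>w \<notin> I\<^sup>k\<close> satisfies \<open>x\<^sub>i w \<in> I\<^sup>k\<close> for all \<open>i\<close>. If the exponent of some
  variable \<open>x\<^sub>i\<close> is a constant \<open>e\<close> on \<open>G(I)\<close> and \<open>x\<^sub>i\<^bsup>ek\<^esup>\<close> divides \<open>w\<close>, then \<open>x\<^sub>i\<close> can be cancelled from
  \<open>x\<^sub>i w \<in> I\<^sup>k\<close>. This excludes \<open>max(u) < n\<close> (\<open>i = n\<close>, \<open>e = 0\<close>) and \<open>min(u) = 1\<close> (\<open>i = e = 1\<close>, where the
  divisibility follows from \<open>x\<^sub>2 w \<in> I\<^sup>k\<close>). Otherwise, for \<open>2 \<le> i \<le> n\<close> let \<open>j(i)\<close> be the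
  least index \<open>j \<ge> i\<close> with \<open>x\<^sub>j\<close> dividing \<open>u\<close>. Both \<open>x\<^sub>1 (u/x\<^bsub>j(i)\<^esub>)\<close> and \<open>x\<^sub>i (u/x\<^bsub>j(i)\<^esub>)\<close> lie in
  \<open>G(I)\<close>. For the product \<open>z\<close> of the former over all \<open>i\<close>, the monomial \<open>w = z/x\<^sub>1\<close> has too small a
  degree to lie in \<open>I\<^bsup>n-1\<^esup>\<close>, but \<open>x\<^sub>i w\<close> is obtained from \<open>z\<close> by exchanging its \<open>i\<close>-th factor.
\<close>

section \<open>Monomials\<close>

lemma lookup_var: "Poly_Mapping.lookup (var i) j = (if i = j then 1 else 0)"
  by (simp add: var_def lookup_single)

lemma keys_var: "Poly_Mapping.keys (var i) = {i}"
  by (simp add: var_def)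

lemma mon_degree_var: "mon_degree (var i) = 1"
  by (simp add: mon_degree_def keys_var lookup_var)

lemma var_add_diff_var:
  assumes "i \<in> Poly_Mapping.keys a"
  shows "var i + (a - var i) = a"
  using assms
  by (intro poly_mapping_eqI) (auto simp: lookup_add lookup_minus lookup_var in_keys_iff)

lemma var_in_monoms: "var i \<in> monoms n \<longleftrightarrow> i \<in> {1..n}"
  by (simp add: monoms_def keys_var)

lemma diff_var_in_monoms: "a \<in> monoms n \<Longrightarrow> a - var i \<in> monoms n"
  by (auto simp: monoms_def in_keys_iff lookup_minus subset_iff)

text \<open>Every monomial other than 1 has a variable to split off. Hence the ideal of the
  variables consists of the polynomials with constant term 0.\<close>

lemma upset_vars: "upset n (var ` {1..n}) = monoms n - {0}"
proof (intro equalityI subsetI)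
  fix a assume "a \<in> upset n (var ` {1..n})"
  then obtain i c where "i \<in> {1..n}" "c \<in> monoms n" "a = var i + c"
    by (auto simp: upset_def)
  moreover from this have "Poly_Mapping.lookup a i \<noteq> 0"
    by (simp add: lookup_add lookup_var)
  ultimately show "a \<in> monoms n - {0}"
    using var_in_monoms monoms_add by auto
next
  fix a assume a: "a \<in> monoms n - {0}"
  then obtain i where i: "i \<in> Poly_Mapping.keys a"
    by (metis DiffD2 all_not_in_conv keys_eq_empty singletonI)
  with a have "i \<in> {1..n}" by (auto simp: monoms_def)
  moreover have "a = var i + (a - var i)" using i by (simp add: var_add_diff_var)
  moreover have "a - var i \<in> monoms n" using a by (simp add: diff_var_in_monoms)
  ultimately show "a \<in> upset n (var ` {1..n})" unfolding upset_def by blast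
qed

text \<open>The cofactor of a generator in \<open>a\<close> has degree
  \<open>mon_degree a - d\<close>, so it is 1 when the degrees agree.\<close>

lemma mon_degree_upset:
  assumes "\<And>a. a \<in> A \<Longrightarrow> mon_degree a = d" and "a \<in> upset n A"
  shows "d \<le> mon_degree a" and "mon_degree a = d \<Longrightarrow> a \<in> A"
proof -
  obtain b c where bc: "b \<in> A" "a = b + c" using assms(2) by (auto simp: upset_def)
  with assms(1) have deg: "mon_degree a = d + mon_degree c" by (simp add: mon_degree_add)
  then show "d \<le> mon_degree a" by simp
  assume "mon_degree a = d"
  with deg have "c = 0" by (simp add: mon_degree_eq_0)
  with bc show "a \<in> A" by simp
qed

section \<open>Products of \<open>k\<close> monomials, the generators of \<open>k\<close>-th
  powers\<close>

primrec mon_pow :: "(nat \<Rightarrow>\<^sub>0 nat) set \<Rightarrow> nat \<Rightarrow> (nat \<Rightarrow>\<^sub>0 nat) set"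
  where
    "mon_pow A 0 = {0}"
  | "mon_pow A (Suc k) = {a + b | a b. a \<in> mon_pow A k \<and> b \<in> A}"

lemma mon_pow_subset_monoms: "A \<subseteq> monoms n \<Longrightarrow> mon_pow A k \<subseteq> monoms n"
proof (induction k)
  case 0
  show ?case by (simp add: monoms_def)
next
  case (Suc k)
  then show ?case by (auto intro!: monoms_add)
qed

lemma mon_degree_mon_pow:
  assumes "\<And>a. a \<in> A \<Longrightarrow> mon_degree a = d"
  shows "b \<in> mon_pow A k \<Longrightarrow> mon_degree b = k * d"
proof (induction k arbitrary: b)
  case 0
  then show ?case by (simp add: mon_degree_def)
qed (auto simp: mon_degree_add assms)

lemma lookup_mon_pow:
  assumes "\<And>a. a \<in> A \<Longrightarrow> Poly_Mapping.lookup a i = e"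
  shows "b \<in> mon_pow A k \<Longrightarrow> Poly_Mapping.lookup b i = k * e"
  by (induction k arbitrary: b) (auto simp: lookup_add assms)

lemma sum_in_mon_pow:
  assumes "finite T" and "\<And>t. t \<in> T \<Longrightarrow> f t \<in> A"
  shows "sum f T \<in> mon_pow A (card T)"
  using assms
proof (induction T)
  case (insert t T)
  then have "sum f T + f t \<in> mon_pow A (Suc (card T))" by auto
  with insert show ?case by (simp add: add.commute)
qed simp

lemma upset_mon_pow_cancel:
  assumes "\<And>a. a \<in> A \<Longrightarrow> Poly_Mapping.lookup a i = e"
    and "w + var i \<in> upset n (mon_pow A k)" and "k * e \<le> Poly_Mapping.lookup w i"
  shows "w \<in> upset n (mon_pow A k)"
proof -
  obtain b c where bc: "b \<in> mon_pow A k" "c \<in> monoms n" "w + var i = b + c"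
    using assms(2) by (auto simp: upset_def)
  have "Poly_Mapping.lookup w i + 1 = k * e + Poly_Mapping.lookup c i"
    using arg_cong[OF bc(3), of "\<lambda>a. Poly_Mapping.lookup a i"] lookup_mon_pow[OF assms(1) bc(1)]
    by (simp add: lookup_add lookup_var)
  with assms(3) have "i \<in> Poly_Mapping.keys c" by (simp add: in_keys_iff)
  then have "w + var i = b + (c - var i) + var i"
    using bc(3) var_add_diff_var[of i c] by (simp add: ac_simps)
  then have "w = b + (c - var i)" by simp
  with bc show ?thesis unfolding upset_def by (blast intro: diff_var_in_monoms)
qed

section \<open>Monomial ideals\<close>

lemma ideal_Idl_monom_poly:
  assumes "A \<subseteq> monoms n"
  shows "ideal (Idl\<^bsub>mpoly_ring n\<^esub> (monom_poly ` A)) (mpoly_ring n :: ((nat \<Rightarrow>\<^sub>0 nat) \<Rightarrow>\<^sub>0 'k::field) ring)"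
proof -
  interpret cring "mpoly_ring n :: ((nat \<Rightarrow>\<^sub>0 nat) \<Rightarrow>\<^sub>0 'k) ring" by (rule cring_mpoly_ring)
  show ?thesis
    using assms by (intro genideal_ideal) (auto simp: mpoly_ring_simps monom_poly_def)
qed

text \<open>First inclusion: each monomial of \<open>p * q\<close> is a product of monomials from
  the two up-sets, and sums stay in the ideal. Second: each generator on the right is a product of
  two generators.\<close>

lemma ideal_prod_Idl_monom_poly:
  assumes A: "A \<subseteq> monoms n" and B: "B \<subseteq> monoms n"
  shows "ideal_prod (mpoly_ring n) (Idl\<^bsub>mpoly_ring n\<^esub> (monom_poly ` A)) (Idl\<^bsub>mpoly_ring n\<^esub> (monom_poly ` B))
    = (Idl\<^bsub>mpoly_ring n\<^esub> (monom_poly ` {a + b | a b. a \<in> A \<and> b \<in> B})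
        :: ((nat \<Rightarrow>\<^sub>0 nat) \<Rightarrow>\<^sub>0 'k::field) set)"
    (is "ideal_prod ?R ?I ?J = Idl\<^bsub>_\<^esub> (monom_poly ` ?C)")
proof
  interpret cring ?R by (rule cring_mpoly_ring)
  have C: "?C \<subseteq> monoms n" using A B by (auto intro: monoms_add)
  have up: "a + b \<in> upset n ?C" if "a \<in> upset n A" "b \<in> upset n B" for a b
  proof -
    obtain a' c where a: "a = a' + c" "a' \<in> A" "c \<in> monoms n" using \<open>a \<in> upset n A\<close> by (auto simp: upset_def)
    obtain b' d where b: "b = b' + d" "b' \<in> B" "d \<in> monoms n" using \<open>b \<in> upset n B\<close> by (auto simp: upset_def)
    have "a + b = (a' + b') + (c + d)" "a' + b' \<in> ?C" "c + d \<in> monoms n"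
      using a b by (auto simp: ac_simps intro: monoms_add)
    then show ?thesis unfolding upset_def by blast
  qed
  show "ideal_prod ?R ?I ?J \<subseteq> Idl\<^bsub>?R\<^esub> (monom_poly ` ?C)"
  proof
    fix p assume "p \<in> ideal_prod ?R ?I ?J"
    then show "p \<in> Idl\<^bsub>?R\<^esub> (monom_poly ` ?C)"
    proof (induction rule: ideal_prod.induct)
      case (prod p q)
      have "Poly_Mapping.keys (p * q) \<subseteq> upset n ?C"
      proof
        fix m assume "m \<in> Poly_Mapping.keys (p * q)"
        then obtain a b where "m = a + b" "a \<in> Poly_Mapping.keys p" "b \<in> Poly_Mapping.keys q"
          using Poly_Mapping.keys_mult[of p q] by blast
        with prod show "m \<in> upset n ?C"
          unfolding Idl_monom_poly[OF A] Idl_monom_poly[OF B] by (auto intro: up)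
      qed
      then show ?case unfolding Idl_monom_poly[OF C] by (simp add: mpoly_ring_simps)
    next
      case (sum p q)
      then show ?case
        using additive_subgroup.a_closed[OF ideal.axioms(1)[OF ideal_Idl_monom_poly[OF C]]] by blast
    qed
  qed
  show "Idl\<^bsub>?R\<^esub> (monom_poly ` ?C) \<subseteq> ideal_prod ?R ?I ?J"
  proof (rule genideal_minimal)
    show "ideal (ideal_prod ?R ?I ?J) ?R"
      by (intro ideal_prod_is_ideal ideal_Idl_monom_poly A B)
    have self: "monom_poly c \<in> (Idl\<^bsub>?R\<^esub> (monom_poly ` D) :: ((nat \<Rightarrow>\<^sub>0 nat) \<Rightarrow>\<^sub>0 'k) set)"
      if "D \<subseteq> monoms n" "c \<in> D" for c D
      using that upset_superset[of D n] unfolding Idl_monom_poly[OF that(1)]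
      by (auto simp: monom_poly_def)
    have "monom_poly (a + b) \<in> ideal_prod ?R ?I ?J" if "a \<in> A" "b \<in> B" for a b
      using ideal_prod.prod[OF self[OF A that(1)] self[OF B that(2)], of ?R]
      by (simp add: mpoly_ring_simps monom_poly_def mult_single)
    then show "monom_poly ` ?C \<subseteq> ideal_prod ?R ?I ?J" by blast
  qed
qed

lemma Idl_monom_poly_pow:
  assumes A: "A \<subseteq> monoms n"
  shows "(Idl\<^bsub>mpoly_ring n\<^esub> (monom_poly ` A)) [^]\<^bsub>ideals_set (mpoly_ring n)\<^esub> (k::nat) =
    (Idl\<^bsub>mpoly_ring n\<^esub> (monom_poly ` mon_pow A k) :: ((nat \<Rightarrow>\<^sub>0 nat) \<Rightarrow>\<^sub>0 'k::field) set)"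
proof (induction k)
  case 0
  \<comment> \<open>The zeroth power is the whole ring, generated by the empty product 1, whose
    exponent vector is 0.\<close>
  have "upset n {0} = monoms n" by (simp add: upset_def)
  moreover have "{0} \<subseteq> monoms n" by (simp add: monoms_def)
  ultimately show ?case
    by (simp add: Idl_monom_poly nat_pow_def ideals_set_def mpoly_ring_simps del: image_insert)
next
  case (Suc k)
  have "(Idl\<^bsub>mpoly_ring n\<^esub> (monom_poly ` A) :: ((nat \<Rightarrow>\<^sub>0 nat) \<Rightarrow>\<^sub>0 'k) set)
      [^]\<^bsub>ideals_set (mpoly_ring n)\<^esub> Suc k =
    ideal_prod (mpoly_ring n)
      ((Idl\<^bsub>mpoly_ring n\<^esub> (monom_poly ` A)) [^]\<^bsub>ideals_set (mpoly_ring n)\<^esub> k)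
      (Idl\<^bsub>mpoly_ring n\<^esub> (monom_poly ` A))"
    by (simp add: nat_pow_def ideals_set_def)
  then show ?case
    unfolding Suc.IH using ideal_prod_Idl_monom_poly[OF mon_pow_subset_monoms[OF A] A] by simp
qed

section \<open>The maximal ideal as an associated prime\<close>

text \<open>Elements of the quotient are cosets of some \<open>p\<close>, and the annihilator of
  such a coset is the colon ideal \<open>J : p\<close>. Later arguments can thus avoid
  cosets.\<close>

lemma (in cring) Ass_iff:
  assumes J: "ideal J R"
  shows "P \<in> Ass R J \<longleftrightarrow>
    primeideal P R \<and> (\<exists>p\<in>carrier R. P = {r \<in> carrier R. r \<otimes> p \<in> J})"
proof -
  interpret J: ideal J R by (rule J)
  have carr: "carrier (R Quot J) = (\<lambda>p. J +> p) ` carrier R"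
    by (auto simp: FactRing_def A_RCOSETS_def')
  have "(J +> r) \<otimes>\<^bsub>R Quot J\<^esub> (J +> p) = \<zero>\<^bsub>R Quot J\<^esub> \<longleftrightarrow> r \<otimes> p \<in> J"
    if "r \<in> carrier R" "p \<in> carrier R" for r p
    using that a_rcos_zero[OF J] J.rcos_const_imp_mem[of "r \<otimes> p"]
    by (auto simp: FactRing_def J.rcoset_mult_add)
  then have "{r \<in> carrier R. (J +> r) \<otimes>\<^bsub>R Quot J\<^esub> (J +> p) = \<zero>\<^bsub>R Quot J\<^esub>} =
      {r \<in> carrier R. r \<otimes> p \<in> J}" if "p \<in> carrier R" for p
    using that by blast
  then show ?thesis unfolding Ass_def carr by simp
qed

text \<open>Exponent vectors are cancellative, so \<open>b\<close> is the only exponent of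
  \<open>p\<close> that contributes.\<close>

lemma lookup_monom_poly_times:
  "Poly_Mapping.lookup (monom_poly a * p) (a + b) = Poly_Mapping.lookup p b"
proof -
  have "Poly_Mapping.lookup (monom_poly a * p) (a + b) =
      (\<Sum>l. (\<Sum>q. Poly_Mapping.lookup p q when a + b = l + q) when a = l)"
    by (simp add: lookup_mult monom_poly_def lookup_single when_mult)
  then show ?thesis by simp
qed

section \<open>Constant terms and primality of the ideal of the variables\<close>

lemma max_hom_ideal_eq:
  "max_hom_ideal n =
    {p :: (nat \<Rightarrow>\<^sub>0 nat) \<Rightarrow>\<^sub>0 'k::field. Poly_Mapping.keys p \<subseteq> monoms n \<and> Poly_Mapping.lookup p 0 = 0}"
proof -
  have vars: "var ` {1..n} \<subseteq> monoms n" by (auto simp: var_in_monoms)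
  show ?thesis
    unfolding max_hom_ideal_def Idl_monom_poly[OF vars] upset_vars
    by (auto simp: in_keys_iff)
qed

lemma ideal_max_hom_ideal:
  "ideal (max_hom_ideal n) (mpoly_ring n :: ((nat \<Rightarrow>\<^sub>0 nat) \<Rightarrow>\<^sub>0 'k::field) ring)"
  unfolding max_hom_ideal_def by (rule ideal_Idl_monom_poly) (auto simp: var_in_monoms)

text \<open>Constant terms multiply, and they lie in a field, which has no zero divisors.\<close>

lemma primeideal_max_hom_ideal:
  "primeideal (max_hom_ideal n) (mpoly_ring n :: ((nat \<Rightarrow>\<^sub>0 nat) \<Rightarrow>\<^sub>0 'k::field) ring)"
proof (rule primeidealI)
  let ?R = "mpoly_ring n :: ((nat \<Rightarrow>\<^sub>0 nat) \<Rightarrow>\<^sub>0 'k) ring"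
  let ?M = "max_hom_ideal n :: ((nat \<Rightarrow>\<^sub>0 nat) \<Rightarrow>\<^sub>0 'k) set"
  show M: "ideal ?M ?R" by (rule ideal_max_hom_ideal)
  show "cring ?R" by (rule cring_mpoly_ring)
  interpret M: ideal ?M ?R by (rule M)
  have "1 \<in> carrier ?R" using M.one_closed by (simp add: mpoly_ring_simps)
  moreover have "1 \<notin> ?M" by (simp add: max_hom_ideal_eq lookup_one)
  ultimately show "carrier ?R \<noteq> ?M" by blast
  show "p \<in> ?M \<or> q \<in> ?M" if p: "p \<in> carrier ?R" and q: "q \<in> carrier ?R" and pq: "p \<otimes>\<^bsub>?R\<^esub> q \<in> ?M" for p q
  proof -
    define a b where "a = Poly_Mapping.lookup p 0" and "b = Poly_Mapping.lookup q 0"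
    define s t where "s = Poly_Mapping.single (0 :: nat \<Rightarrow>\<^sub>0 nat) a"
      and "t = Poly_Mapping.single (0 :: nat \<Rightarrow>\<^sub>0 nat) b"
    have carr: "s \<in> carrier ?R" "t \<in> carrier ?R"
      by (auto simp: s_def t_def mpoly_ring_simps monoms_def)
    have diff: "x - y \<in> ?M" if "x \<in> carrier ?R" "y \<in> carrier ?R"
      "Poly_Mapping.lookup x 0 = Poly_Mapping.lookup y 0" for x y
      using that Poly_Mapping.keys_diff[of x y]
      by (auto simp: max_hom_ideal_eq mpoly_ring_simps lookup_minus)
    have "(p - s) * q \<in> ?M"
      using M.I_r_closed[OF diff[OF p carr(1)] q]
      by (simp add: a_def s_def mpoly_ring_simps)
    moreover have "s * (q - t) \<in> ?M"
      using M.I_l_closed[OF diff[OF q carr(2)] carr(1)]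
      by (simp add: b_def t_def mpoly_ring_simps)
    \<comment> \<open>The first two summands have constant term 0, so \<open>p * q\<close> and
      \<open>s * t\<close> have the same constant term, namely \<open>a * b\<close>.\<close>
    moreover have "p * q = (p - s) * q + s * (q - t) + s * t" by (simp add: algebra_simps)
    ultimately have "Poly_Mapping.lookup (s * t) 0 = 0"
      using pq by (auto simp: max_hom_ideal_eq mpoly_ring_simps lookup_add)
    then have "a * b = 0" by (simp add: s_def t_def mult_single)
    then show ?thesis
      using p q by (auto simp: max_hom_ideal_eq mpoly_ring_simps a_def b_def)
  qed
qed

text \<open>A monomial ideal contains a polynomial iff it contains all its monomials. So any
  monomial outside \<open>?J\<close> of a polynomial with annihilator \<open>?M\<close> can serve as
  \<open>w\<close>; conversely, such a \<open>w\<close> itself has annihilator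
  \<open>?M\<close>.\<close>

lemma max_hom_ideal_in_Ass_iff:
  assumes A: "A \<subseteq> monoms n"
  shows "max_hom_ideal n \<in> Ass (mpoly_ring n)
      (Idl\<^bsub>mpoly_ring n\<^esub> (monom_poly ` A) :: ((nat \<Rightarrow>\<^sub>0 nat) \<Rightarrow>\<^sub>0 'k::field) set) \<longleftrightarrow>
    (\<exists>w\<in>monoms n. w \<notin> upset n A \<and> (\<forall>i\<in>{1..n}. w + var i \<in> upset n A))"
    (is "?M \<in> Ass ?R ?J \<longleftrightarrow> ?rhs")
proof -
  interpret cring ?R by (rule cring_mpoly_ring)
  have J: "?J = {p. Poly_Mapping.keys p \<subseteq> upset n A}" by (rule Idl_monom_poly[OF A])
  have "(\<exists>p\<in>carrier ?R. ?M = {r \<in> carrier ?R. r \<otimes>\<^bsub>?R\<^esub> p \<in> ?J}) \<longleftrightarrow> ?rhs"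
  proof
    assume "\<exists>p\<in>carrier ?R. ?M = {r \<in> carrier ?R. r \<otimes>\<^bsub>?R\<^esub> p \<in> ?J}"
    then obtain p where p: "p \<in> carrier ?R" "?M = {r \<in> carrier ?R. r \<otimes>\<^bsub>?R\<^esub> p \<in> ?J}" by blast
    have "(1 :: (nat \<Rightarrow>\<^sub>0 nat) \<Rightarrow>\<^sub>0 'k) \<in> carrier ?R" using one_closed by (simp add: mpoly_ring_simps)
    moreover have "(1 :: (nat \<Rightarrow>\<^sub>0 nat) \<Rightarrow>\<^sub>0 'k) \<notin> ?M" by (simp add: max_hom_ideal_eq lookup_one)
    \<comment> \<open>This is the case \<open>r = 1\<close> of the description of
      \<open>?M\<close>.\<close>
    ultimately have "p \<notin> ?J" unfolding p(2) by (simp add: mpoly_ring_simps)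
    then obtain w where w: "w \<in> Poly_Mapping.keys p" "w \<notin> upset n A" unfolding J by blast
    have "w + var i \<in> upset n A" if "i \<in> {1..n}" for i
    proof -
      have "0 \<noteq> var i" using keys_var[of i] by force
      with that have "monom_poly (var i) \<in> ?M"
        by (simp add: max_hom_ideal_eq monom_poly_def var_in_monoms lookup_single)
      then have "Poly_Mapping.keys (monom_poly (var i) * p) \<subseteq> upset n A"
        unfolding p(2) by (simp add: mpoly_ring_simps J)
      moreover have "var i + w \<in> Poly_Mapping.keys (monom_poly (var i) * p)"
        using w(1) unfolding in_keys_iff lookup_monom_poly_times .
      ultimately show ?thesis by (auto simp: add.commute)
    qed
    with w p(1) show ?rhs by (auto simp: mpoly_ring_simps)
  next
    assume ?rhs
    then obtain w where w: "w \<in> monoms n" "w \<notin> upset n A"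
      and wi: "\<And>i. i \<in> {1..n} \<Longrightarrow> w + var i \<in> upset n A" by blast
    \<comment> \<open>The coefficient of \<open>w\<close> in \<open>r * monom_poly w\<close> is the
      constant term of \<open>r\<close>. Every other monomial of \<open>r\<close> contains a
      variable, which takes \<open>w\<close> into the up-set.\<close>
    have "r * monom_poly w \<in> ?J \<longleftrightarrow> Poly_Mapping.lookup r 0 = 0" if r: "r \<in> carrier ?R" for r
    proof
      assume "r * monom_poly w \<in> ?J"
      with w(2) have "w \<notin> Poly_Mapping.keys (monom_poly w * r)"
        by (auto simp: J mult.commute)
      then show "Poly_Mapping.lookup r 0 = 0"
        using lookup_monom_poly_times[of w r 0] by (simp add: in_keys_iff)
    next
      assume 0: "Poly_Mapping.lookup r 0 = 0"
      have "m \<in> upset n A" if m: "m \<in> Poly_Mapping.keys (r * monom_poly w)" for m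
      proof -
        obtain c where c: "c \<in> Poly_Mapping.keys r" "m = c + w"
          using m Poly_Mapping.keys_mult[of r "monom_poly w"] by (auto simp: monom_poly_def)
        with r 0 have "c \<in> upset n (var ` {1..n})"
          unfolding upset_vars by (auto simp: mpoly_ring_simps in_keys_iff)
        then obtain i e where "i \<in> {1..n}" "e \<in> monoms n" "c = var i + e"
          by (auto simp: upset_def)
        with c(2) upset_add[OF wi] show ?thesis by (simp add: ac_simps)
      qed
      then show "r * monom_poly w \<in> ?J" unfolding J by blast
    qed
    then have "?M = {r \<in> carrier ?R. r \<otimes>\<^bsub>?R\<^esub> monom_poly w \<in> ?J}"
      by (auto simp: max_hom_ideal_eq mpoly_ring_simps)
    moreover have "monom_poly w \<in> carrier ?R"
      using w(1) by (simp add: mpoly_ring_simps monom_poly_def)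
    ultimately show "\<exists>p\<in>carrier ?R. ?M = {r \<in> carrier ?R. r \<otimes>\<^bsub>?R\<^esub> p \<in> ?J}" by blast
  qed
  then show ?thesis
    using Ass_iff[OF ideal_Idl_monom_poly[OF A], of ?M] primeideal_max_hom_ideal by blast
qed

section \<open>Squarefree strongly stable ideals\<close>

lemma is_min_mon_gens_min_gens:
  "monomial_ideal n I \<Longrightarrow> is_min_mon_gens n I (min_gens n I)"
  unfolding min_gens_def by (rule theI') (rule ex1_min_mon_gens)

text \<open>Distinct monomials of equal degree do not divide one another, so no generator is
  redundant.\<close>

lemma min_gens_Idl:
  assumes F: "F \<subseteq> monoms n" and deg: "\<And>a. a \<in> F \<Longrightarrow> mon_degree a = d"
  shows "min_gens n (Idl\<^bsub>mpoly_ring n\<^esub> (monom_poly ` F) :: ((nat \<Rightarrow>\<^sub>0 nat) \<Rightarrow>\<^sub>0 'k::field) set) = F"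
proof -
  have "mon_minimal n (upset n F) = F"
  proof (intro equalityI subsetI)
    fix a assume a: "a \<in> mon_minimal n (upset n F)"
    then obtain b c where "b \<in> F" "c \<in> monoms n" "a = b + c"
      by (auto simp: mon_minimal_def upset_def)
    moreover from this have "b \<in> upset n F" using upset_superset by blast
    ultimately show "a \<in> F" using a by (auto simp: mon_minimal_def)
  next
    fix a assume a: "a \<in> F"
    have "c = 0" if "b \<in> upset n F" "a = b + c" for b c
      using mon_degree_upset(1)[OF deg that(1)] deg[OF a] that(2)
      by (auto simp: mon_degree_add intro: mon_degree_eq_0)
    with a upset_superset[of F n] show "a \<in> mon_minimal n (upset n F)"
      by (auto simp: mon_minimal_def)
  qed
  then show ?thesis unfolding min_gens_def is_min_mon_gens_iff[OF F] by simp
qed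

text \<open>An induction principle in place of the explicit description of \<open>G(I)\<close>:
  conditions preserved by \<open>move\<close> pass from \<open>u\<close> to all generators. The
  ideal generated by \<open>F\<close> is squarefree strongly stable and contains \<open>u\<close>,
  hence contains \<open>I\<close>; comparing degrees leads back from the up-set to
  \<open>F\<close>.\<close>

lemma sss_principal_min_gens_subset:
  fixes I :: "((nat \<Rightarrow>\<^sub>0 nat) \<Rightarrow>\<^sub>0 'k::field) set"
  assumes I: "sss_principal n I u"
    and F: "F \<subseteq> monoms n" and u: "u \<in> F"
    and deg: "\<And>a. a \<in> F \<Longrightarrow> mon_degree a = mon_degree u"
    and sqf: "\<And>a. a \<in> F \<Longrightarrow> mon_squarefree a"
    and move: "\<And>a i j. a \<in> F \<Longrightarrow> 1 \<le> i \<Longrightarrow> i < j \<Longrightarrow> j \<le> n \<Longrightarrow> j \<in> Poly_Mapping.keys a \<Longrightarrow>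
      i \<notin> Poly_Mapping.keys a \<Longrightarrow> var i + (a - var j) \<in> F"
  shows "min_gens n I \<subseteq> F"
proof
  let ?J = "Idl\<^bsub>mpoly_ring n\<^esub> (monom_poly ` F) :: ((nat \<Rightarrow>\<^sub>0 nat) \<Rightarrow>\<^sub>0 'k) set"
  have G: "min_gens n ?J = F" using F deg by (rule min_gens_Idl)
  have "squarefree_strongly_stable n ?J"
    unfolding squarefree_strongly_stable_def G monomial_ideal_def using F deg sqf move by blast
  moreover have "monom_poly u \<in> ?J"
    using u upset_superset[of F n] unfolding Idl_monom_poly[OF F] by (auto simp: monom_poly_def)
  ultimately have IJ: "I \<subseteq> ?J" using I by (simp add: sss_principal_def)
  have sss: "squarefree_strongly_stable n I" and uG: "u \<in> min_gens n I"
    using I by (simp_all add: sss_principal_def)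
  then have "is_min_mon_gens n I (min_gens n I)"
    by (simp add: squarefree_strongly_stable_def is_min_mon_gens_min_gens)
  then have GI: "min_gens n I \<subseteq> monoms n" "I = Idl\<^bsub>mpoly_ring n\<^esub> (monom_poly ` min_gens n I)"
    unfolding is_min_mon_gens_def by blast+
  fix a assume a: "a \<in> min_gens n I"
  then have "monom_poly a \<in> I"
    using upset_superset[of "min_gens n I" n]
    by (subst GI(2), subst Idl_monom_poly[OF GI(1)]) (auto simp: monom_poly_def)
  with IJ have "a \<in> upset n F"
    unfolding Idl_monom_poly[OF F] by (auto simp: monom_poly_def)
  moreover have "mon_degree a = mon_degree u"
    using sss a uG unfolding squarefree_strongly_stable_def by metis
  ultimately show "a \<in> F" using mon_degree_upset(2)[OF deg] by blast
qed

section \<open>Conditions preserved by the moves \<open>x\<^sub>i (a/x\<^sub>j)\<close> with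
  \<open>i < j\<close>\<close>

lemma squarefree_move:
  assumes "a \<in> monoms n" "mon_squarefree a" "1 \<le> i" "i < j" "j \<le> n"
    and "j \<in> Poly_Mapping.keys a" "i \<notin> Poly_Mapping.keys a"
  shows "var i + (a - var j) \<in> monoms n" "mon_squarefree (var i + (a - var j))"
    and "mon_degree (var i + (a - var j)) = mon_degree a"
proof -
  show "var i + (a - var j) \<in> monoms n"
    using assms by (intro monoms_add diff_var_in_monoms) (auto simp: var_in_monoms)
  show "mon_squarefree (var i + (a - var j))"
    using assms by (auto simp: mon_squarefree_def lookup_add lookup_minus lookup_var in_keys_iff
        intro: order_trans[OF diff_le_self])
  have "mon_degree a = 1 + mon_degree (a - var j)"
    using arg_cong[OF var_add_diff_var[OF assms(6)], of mon_degree]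
    by (simp add: mon_degree_add mon_degree_var)
  then show "mon_degree (var i + (a - var j)) = mon_degree a"
    by (simp add: mon_degree_add mon_degree_var)
qed

text \<open>A move brings in a smaller index than the one it removes, so an upper bound on the
  indices persists.\<close>

lemma sss_principal_keys_bound:
  assumes I: "sss_principal n I u" and u: "u \<in> monoms n" "mon_squarefree u"
    and a: "a \<in> min_gens n I" and m: "Poly_Mapping.keys u \<subseteq> {..m}"
  shows "Poly_Mapping.keys a \<subseteq> {..m}"
proof -
  let ?F = "{a \<in> monoms n. mon_squarefree a \<and> mon_degree a = mon_degree u \<and> Poly_Mapping.keys a \<subseteq> {..m}}"
  have "Poly_Mapping.keys (var i + (b - var j)) \<subseteq> {..m}"
    if "Poly_Mapping.keys b \<subseteq> {..m}" "i < j" "j \<in> Poly_Mapping.keys b" for b i j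
  proof -
    have "i \<le> m" using that by auto
    moreover have "Poly_Mapping.keys (b - var j) \<subseteq> Poly_Mapping.keys b"
      by (auto simp: in_keys_iff lookup_minus)
    ultimately show ?thesis
      using Poly_Mapping.keys_add[of "var i" "b - var j"] that(1) by (auto simp: keys_var)
  qed
  then have "min_gens n I \<subseteq> ?F"
    using u m by (intro sss_principal_min_gens_subset[OF I]) (auto simp: squarefree_move)
  with a show ?thesis by blast
qed

text \<open>A move removes \<open>x\<^sub>j\<close> with \<open>j > i \<ge> 1\<close>, never
  \<open>x\<^sub>1\<close>; squarefreeness then fixes the exponent.\<close>

lemma sss_principal_keys_one:
  assumes I: "sss_principal n I u" and u: "u \<in> monoms n" "mon_squarefree u"
    and a: "a \<in> min_gens n I" and "1 \<in> Poly_Mapping.keys u"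
  shows "Poly_Mapping.lookup a 1 = 1"
proof -
  let ?F = "{a \<in> monoms n. mon_squarefree a \<and> mon_degree a = mon_degree u \<and> 1 \<in> Poly_Mapping.keys a}"
  have "1 \<in> Poly_Mapping.keys (var i + (b - var j))"
    if "1 \<in> Poly_Mapping.keys b" "1 \<le> i" "i < j" for b i j
    using that by (auto simp: in_keys_iff lookup_add lookup_minus lookup_var)
  then have "min_gens n I \<subseteq> ?F"
    using u assms(5) by (intro sss_principal_min_gens_subset[OF I]) (auto simp: squarefree_move)
  with a have "mon_squarefree a" "1 \<in> Poly_Mapping.keys a" by auto
  then show ?thesis
    unfolding mon_squarefree_def in_keys_iff by (metis One_nat_def le_Suc_eq le_zero_eq)
qed

text \<open>In the application \<open>q i\<close> is \<open>u - var (j i)\<close>. One factor for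
  each \<open>i\<close> in \<open>{2..n}\<close> gives the exponent \<open>n - 1\<close>.\<close>

lemma exchange_witness:
  assumes G: "\<And>a. a \<in> G \<Longrightarrow> mon_degree a = d" "G \<subseteq> monoms n" and n: "2 \<le> n" and d: "1 \<le> d"
    and q: "\<And>i. i \<in> {2..n} \<Longrightarrow> var 1 + q i \<in> G" "\<And>i. i \<in> {2..n} \<Longrightarrow> var i + q i \<in> G"
  shows "\<exists>w\<in>monoms n. w \<notin> upset n (mon_pow G (n - 1)) \<and>
    (\<forall>i\<in>{1..n}. w + var i \<in> upset n (mon_pow G (n - 1)))"
proof -
  let ?T = "{2..n}"
  let ?z = "\<Sum>i\<in>?T. var 1 + q i"
  \<comment> \<open>This is \<open>?z\<close> divided by \<open>x\<^sub>1\<close>, where the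
    \<open>x\<^sub>1\<close> is taken from the factor with index 2.\<close>
  define w where "w = q 2 + (\<Sum>i\<in>?T - {2}. var 1 + q i)"
  have w: "w + var 1 = ?z"
    using n sum.remove[of ?T 2 "\<lambda>i. var 1 + q i"] by (simp add: w_def ac_simps)
  have card: "card ?T = n - 1" by simp
  have z: "?z \<in> mon_pow G (n - 1)"
    using sum_in_mon_pow[of ?T "\<lambda>i. var 1 + q i" G] q(1) card by simp
  have "w + var i \<in> mon_pow G (n - 1)" if i: "i \<in> {1..n}" for i
  proof (cases "i = 1")
    case True
    with w z show ?thesis by simp
  next
    case False
    with i have i: "i \<in> ?T" by simp
    let ?f = "\<lambda>l. if l = i then var i + q i else var 1 + q l"
    \<comment> \<open>With an extra \<open>var 1\<close> the exchange takes place inside the full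
      product \<open>?z\<close>, so \<open>i = 2\<close> needs no separate case; it is cancelled at
      the end.\<close>
    have "(w + var i) + var 1 = ?z + var i"
      unfolding w[symmetric] by (simp add: ac_simps)
    also have "\<dots> = var 1 + (var i + q i) + (\<Sum>l\<in>?T - {i}. var 1 + q l)"
      using sum.remove[OF _ i, of "\<lambda>i. var 1 + q i"] by (simp add: ac_simps)
    also have "(\<Sum>l\<in>?T - {i}. var 1 + q l) = sum ?f (?T - {i})"
      by (intro sum.cong) auto
    also have "var 1 + (var i + q i) + sum ?f (?T - {i}) = sum ?f ?T + var 1"
      using sum.remove[OF _ i, of ?f] by (simp add: ac_simps)
    finally have "w + var i = sum ?f ?T" by simp
    moreover have "sum ?f ?T \<in> mon_pow G (card ?T)"
      by (rule sum_in_mon_pow) (use q in auto)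
    ultimately show ?thesis using card by simp
  qed
  then have "\<forall>i\<in>{1..n}. w + var i \<in> upset n (mon_pow G (n - 1))"
    using upset_superset by blast
  moreover have "w \<notin> upset n (mon_pow G (n - 1))"
  proof
    assume "w \<in> upset n (mon_pow G (n - 1))"
    \<comment> \<open>The degree of \<open>w\<close> is one less than that of the generators of the
      power.\<close>
    then have "(n - 1) * d \<le> mon_degree w"
      using mon_degree_upset(1)[of "mon_pow G (n - 1)"] mon_degree_mon_pow[OF G(1)] by blast
    moreover have "mon_degree w + 1 = (n - 1) * d"
      using mon_degree_mon_pow[OF G(1) z] unfolding w[symmetric]
      by (simp add: mon_degree_add mon_degree_var)
    ultimately show False by simp
  qed
  moreover have "w \<in> monoms n"
  proof -
    have "w + var 1 \<in> monoms n" using z w mon_pow_subset_monoms[OF G(2)] by auto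
    then show ?thesis using monoms_addD by blast
  qed
  ultimately show ?thesis by blast
qed

theorem theorem2p1:
  fixes n d :: nat
    and I :: "((nat \<Rightarrow>\<^sub>0 nat) \<Rightarrow>\<^sub>0 'k::field) set"
    and u :: "nat \<Rightarrow>\<^sub>0 nat"
  assumes "u \<in> monoms n" and "mon_squarefree u" and "mon_degree u = d" and "d \<ge> 1"
    and "u \<noteq> var 1"
    and "sss_principal n I u"
  shows "(\<exists>k::nat. k \<ge> 1 \<and>
      max_hom_ideal n \<in> Ass (mpoly_ring n) (I [^]\<^bsub>ideals_set (mpoly_ring n)\<^esub> k)) \<longleftrightarrow>
    mon_min u > 1 \<and> mon_max u = n"
proof -
  define G where "G = min_gens n I"
  have sss: "squarefree_strongly_stable n I" and uG: "u \<in> G"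
    using assms(6) by (simp_all add: sss_principal_def G_def)
  then have "is_min_mon_gens n I G"
    by (simp add: squarefree_strongly_stable_def is_min_mon_gens_min_gens G_def)
  then have G: "G \<subseteq> monoms n" and I: "I = Idl\<^bsub>mpoly_ring n\<^esub> (monom_poly ` G)"
    unfolding is_min_mon_gens_def by blast+
  have deg: "mon_degree a = d" if "a \<in> G" for a
    using sss that uG assms(3) unfolding squarefree_strongly_stable_def G_def by metis
  have move: "var i + (u - var j) \<in> G"
    if "1 \<le> i" "i < j" "j \<in> Poly_Mapping.keys u" "i \<notin> Poly_Mapping.keys u" for i j
    using sss uG that assms(1) unfolding squarefree_strongly_stable_def G_def monoms_def by auto
  have Ass_iff: "max_hom_ideal n \<in> Ass (mpoly_ring n) (I [^]\<^bsub>ideals_set (mpoly_ring n)\<^esub> k) \<longleftrightarrow>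
      (\<exists>w\<in>monoms n. w \<notin> upset n (mon_pow G k) \<and> (\<forall>i\<in>{1..n}. w + var i \<in> upset n (mon_pow G k)))"
    for k :: nat
    unfolding I Idl_monom_poly_pow[OF G] by (rule max_hom_ideal_in_Ass_iff[OF mon_pow_subset_monoms[OF G]])
  \<comment> \<open>As \<open>d \<ge> 1\<close>, the support is nonempty, so the \<open>Min\<close>
    and \<open>Max\<close> behind \<open>mon_min\<close> and \<open>mon_max\<close> are
    attained.\<close>
  have keys: "Poly_Mapping.keys u \<subseteq> {1..n}" "Poly_Mapping.keys u \<noteq> {}"
    using assms(1,3,4) by (auto simp: monoms_def mon_degree_def)
  show ?thesis
  proof
    assume "\<exists>k::nat. k \<ge> 1 \<and> max_hom_ideal n \<in> Ass (mpoly_ring n) (I [^]\<^bsub>ideals_set (mpoly_ring n)\<^esub> k)"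
    then obtain k w where w: "w \<notin> upset n (mon_pow G k)"
      and wi: "\<And>i. i \<in> {1..n} \<Longrightarrow> w + var i \<in> upset n (mon_pow G k)"
      unfolding Ass_iff by blast
    have max: "mon_max u = n"
    proof (rule ccontr)
      assume "mon_max u \<noteq> n"
      moreover have "mon_max u \<in> Poly_Mapping.keys u" using keys(2) by (simp add: mon_max_def)
      ultimately have "mon_max u < n" using keys(1) by force
      have "Poly_Mapping.keys u \<subseteq> {..mon_max u}" by (auto simp: mon_max_def)
      \<comment> \<open>No generator contains \<open>x\<^sub>n\<close>, so cancellation with
        \<open>e = 0\<close> puts \<open>w\<close> itself into the power.\<close>
      then have "Poly_Mapping.lookup a n = 0" if "a \<in> G" for a
        using sss_principal_keys_bound[OF assms(6,1,2), of a "mon_max u"] that \<open>mon_max u < n\<close>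
        by (auto simp: G_def in_keys_iff subset_iff)
      moreover have "n \<in> {1..n}" using \<open>mon_max u < n\<close> by simp
      ultimately show False using upset_mon_pow_cancel[of G n 0 w n k] w wi by simp
    qed
    have "mon_min u > 1"
    proof (rule ccontr)
      assume "\<not> mon_min u > 1"
      moreover have "mon_min u \<in> Poly_Mapping.keys u" using keys(2) by (simp add: mon_min_def)
      ultimately have one: "1 \<in> Poly_Mapping.keys u"
        using keys(1) by (metis atLeastAtMost_iff le_antisym not_less subsetD)
      \<comment> \<open>The argument below multiplies by \<open>x\<^sub>2\<close>. For
        \<open>n = 1\<close> the squarefree \<open>u\<close>, divisible by \<open>x\<^sub>1\<close>,
        would be the excluded \<open>x\<^sub>1\<close>.\<close>
      have "n \<noteq> 1"
      proof
        assume "n = 1"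
        have "Poly_Mapping.lookup u i = Poly_Mapping.lookup (var 1) i" for i
        proof (cases "i = 1")
          case True
          with sss_principal_keys_one[OF assms(6,1,2) _ one] uG show ?thesis
            by (simp add: G_def lookup_var)
        next
          case False
          with keys(1) \<open>n = 1\<close> show ?thesis by (auto simp: lookup_var in_keys_iff subset_iff)
        qed
        with assms(5) show False by (blast intro: poly_mapping_eqI)
      qed
      with one keys(1) have n: "2 \<le> n" by force
      have G1: "Poly_Mapping.lookup a 1 = 1" if "a \<in> G" for a
        using sss_principal_keys_one[OF assms(6,1,2) _ one] that by (simp add: G_def)
      \<comment> \<open>Multiplying by \<open>x\<^sub>2\<close> leaves the exponent of
        \<open>x\<^sub>1\<close> unchanged, and that exponent is \<open>k\<close> in
        \<open>b\<close>. So it is at least \<open>k\<close> in \<open>w\<close>, as cancellation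
        with \<open>e = 1\<close> requires.\<close>
      obtain b c where bc: "b \<in> mon_pow G k" "w + var 2 = b + c"
        using wi[of 2] n by (auto simp: upset_def)
      have "Poly_Mapping.lookup w 1 = Poly_Mapping.lookup (b + c) 1"
        unfolding bc(2)[symmetric] by (simp add: lookup_add lookup_var)
      then have "k * 1 \<le> Poly_Mapping.lookup w 1"
        using lookup_mon_pow[OF G1 bc(1)] by (simp add: lookup_add)
      then show False using upset_mon_pow_cancel[OF G1 wi] w n by simp
    qed
    with max show "mon_min u > 1 \<and> mon_max u = n" by blast
  next
    assume u: "mon_min u > 1 \<and> mon_max u = n"
    then have nu: "n \<in> Poly_Mapping.keys u"
      using keys(2) Max_in[of "Poly_Mapping.keys u"] by (simp add: mon_max_def)
    have u1: "1 < j" if "j \<in> Poly_Mapping.keys u" for j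
      using u that unfolding mon_min_def by (meson Min_le finite_keys less_le_trans)
    \<comment> \<open>The least element exists because \<open>n\<close> qualifies. Leastness gives
      \<open>j i = i\<close> when \<open>x\<^sub>i\<close> divides \<open>u\<close>; the exchange
      then returns \<open>u\<close> itself.\<close>
    define j where "j i = (LEAST l. l \<in> Poly_Mapping.keys u \<and> i \<le> l)" for i
    have j: "j i \<in> Poly_Mapping.keys u" "i \<le> j i" if "i \<in> {2..n}" for i
      using LeastI[of "\<lambda>l. l \<in> Poly_Mapping.keys u \<and> i \<le> l" n] nu that by (auto simp: j_def)
    \<comment> \<open>All indices of \<open>u\<close> exceed 1, so the move from \<open>j i\<close>
      to 1 is allowed.\<close>
    have "var 1 + (u - var (j i)) \<in> G" if "i \<in> {2..n}" for i
      using move[of 1 "j i"] j(1)[OF that] u1 by blast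
    moreover have "var i + (u - var (j i)) \<in> G" if i: "i \<in> {2..n}" for i
    proof (cases "i \<in> Poly_Mapping.keys u")
      case True
      then have "j i = i" unfolding j_def by (intro Least_equality) auto
      with True uG show ?thesis by (simp add: var_add_diff_var)
    next
      case False
      with j[OF i] have "i < j i" by (metis le_neq_implies_less)
      with False j[OF i] i show ?thesis by (intro move) auto
    qed
    moreover have "2 \<le> n" using u1[OF nu] by simp
    ultimately have "\<exists>w\<in>monoms n. w \<notin> upset n (mon_pow G (n - 1)) \<and>
        (\<forall>i\<in>{1..n}. w + var i \<in> upset n (mon_pow G (n - 1)))"
      using deg G assms(4) by (intro exchange_witness) auto
    moreover have "1 \<le> n - 1" using \<open>2 \<le> n\<close> by simp
    ultimately show "\<exists>k::nat. k \<ge> 1 \<and> max_hom_ideal n \<in> Ass (mpoly_ring n) (I [^]\<^bsub>ideals_set (mpoly_ring n)\<^esub> k)"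
      unfolding Ass_iff by blast
  qed
qed

end
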